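(* Let $X$ be a topological space with a free interval $J$ and let $f:X\to X$ be a continuous map. Then $$\overline{\operatorname{Rec}(f)}\cap J=\left[\operatorname{Rec}(f)\cup\overline{\operatorname{Per}(f)}\right]\cap J.$$
   Context: A free interval of a topological space $X$ is an open subset of $X$ homeomorphic to an open interval of the real line. $\operatorname{Per}(f)$ is the set of periodic points of $f$ (points $x\in X$ with $f^n(x)=x$ for some integer $n\ge 1$). $\operatorname{Rec}(f)$ is the set of recurrent points of $f$ (points $x\in X$ such that for every neighborhood $U$ of $x$ there are arbitrarily large $n$ with $f^n(x)\in U$). The bar denotes closure in $X$.
   Formalization: The topological space X is assumed to be Hausdorff; for arbitrary topological spaces the equality fails (e.g. an open interval with an extra point whose only neighborhood is the whole space, under an irrational rotation sending one point to it). *)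

theory Defs
  imports "HOL-Analysis.Analysis"
begin

(* The ambient space of the theorem has to be Hausdorff (class t2_space).
   For X = (0,1) together with a point p whose only neighbourhood is X, the map
   f(r) = r + a mod 1 (a in (0,1) irrational), f(1 - a) = p, f(p) = p is continuous,
   no point of (0,1) is periodic or in the closure of {p}, every rational point of (0,1)
   is recurrent, and 1 - a is not. *)

definition free_interval :: "'a::topological_space set \<Rightarrow> bool" where
  "free_interval J \<longleftrightarrow>
     open J \<and> (\<exists>I::real set. open I \<and> is_interval I \<and> I \<noteq> {} \<and> J homeomorphic I)"

definition Per :: "('a \<Rightarrow> 'a) \<Rightarrow> 'a set" where
  "Per f = {x. \<exists>n\<ge>1. (f ^^ n) x = x}"

definition Rec :: "('a::topological_space \<Rightarrow> 'a) \<Rightarrow> 'a set" where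
  "Rec f = {x. \<forall>U. open U \<and> x \<in> U \<longrightarrow> (\<forall>N. \<exists>n\<ge>N. (f ^^ n) x \<in> U)}"

end

theory Submission
  imports Defs
begin

text \<open>Suppose \<open>x \<in> J\<close> is a limit of recurrent points but neither recurrent nor a limit of
  periodic points. Shrinking \<open>J\<close>, we may assume that \<open>J\<close> has no periodic points and that the
  orbit of \<open>x\<close> never returns to \<open>J\<close>; say recurrent points accumulate at \<open>x\<close> from the right.
  If \<open>y > x\<close> returns to \<open>J\<close> under \<open>f\<^sup>n\<close>, then, moving from \<open>y\<close> to the left, the image under
  \<open>f\<^sup>n\<close> must leave \<open>J\<close> before \<open>x\<close> is reached, and as \<open>f\<^sup>n\<close> has no fixed point in \<open>J\<close>
  it leaves through the left end if \<open>f\<^sup>n y < y\<close> and through the right end if \<open>f\<^sup>n y > y\<close>.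
  Recurrence provides returns of both kinds. A return to the left gives \<open>t < y\<close> such that \<open>f\<^sup>n\<close>
  stretches \<open>[t, y]\<close> over \<open>[x, f\<^sup>n y]\<close>; a return to the right of a point close to \<open>x\<close> then gives
  an interval close to \<open>x\<close> which some \<open>f\<^sup>m\<close> stretches over \<open>[t, y]\<close>. Hence \<open>f\<^bsup>n+m\<^esup>\<close>
  has a fixed point in \<open>J\<close>, a contradiction.\<close>

lemma continuous_on_funpow_UNIV:
  fixes f :: "'a::topological_space \<Rightarrow> 'a"
  assumes "continuous_on UNIV f"
  shows "continuous_on A (f ^^ n)"
proof (rule continuous_on_subset)
  show "continuous_on UNIV (f ^^ n)"
  proof (induction n)
    case (Suc n)
    then show ?case
      using continuous_on_compose2[OF assms Suc] by simp
  qed (simp add: id_def)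
qed simp

lemma Per_subset_Rec: "Per f \<subseteq> Rec f"
proof
  fix x assume "x \<in> Per f"
  then obtain n where n: "n \<ge> 1" "(f ^^ n) x = x"
    by (auto simp: Per_def)
  have "(f ^^ (n * k)) x = x" for k
    using n(2) by (induction k) (simp_all add: funpow_add)
  moreover have "n * k \<ge> k" for k
    using n(1) by simp
  ultimately show "x \<in> Rec f"
    unfolding Rec_def mem_Collect_eq by metis
qed

locale open_arc =
  fixes \<phi> :: "real \<Rightarrow> 'a::t2_space" and a b :: real
  assumes cont: "continuous_on {a..b} \<phi>"
    and inj: "inj_on \<phi> {a..b}"
    and open_image: "\<And>c d. a \<le> c \<Longrightarrow> d \<le> b \<Longrightarrow> open (\<phi> ` {c<..<d})"
begin

definition \<psi> :: "'a \<Rightarrow> real" where "\<psi> = the_inv_into {a..b} \<phi>"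

lemma \<psi>_\<phi> [simp]: "s \<in> {a..b} \<Longrightarrow> \<psi> (\<phi> s) = s"
  unfolding \<psi>_def by (rule the_inv_into_f_f[OF inj])

lemma cont_\<psi>: "continuous_on (\<phi> ` {a..b}) \<psi>"
  by (rule continuous_on_inv[OF cont]) auto

lemma closed_image: "a \<le> c \<Longrightarrow> d \<le> b \<Longrightarrow> closed (\<phi> ` {c..d})"
  by (intro compact_imp_closed compact_continuous_image continuous_on_subset[OF cont]) auto

lemma continuous_coordinate:
  assumes "continuous_on UNIV F" "A \<subseteq> {a..b}" "\<And>s. s \<in> A \<Longrightarrow> F (\<phi> s) \<in> \<phi> ` {a..b}"
  shows "continuous_on A (\<lambda>s. \<psi> (F (\<phi> s)))"
proof -
  have "continuous_on A (\<lambda>s. F (\<phi> s))"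
    using continuous_on_compose2[OF assms(1) continuous_on_subset[OF cont assms(2)]] by auto
  then show ?thesis
    using continuous_on_compose2[OF cont_\<psi>] assms(3) by auto
qed

text \<open>The last exit of \<open>F \<circ> \<phi>\<close> from the subarc \<open>(l, u)\<close>, moving from \<open>q\<close> to the left.\<close>
lemma exit_endpoint:
  assumes F: "continuous_on UNIV F"
    and pq: "a \<le> p" "p < q" "q \<le> b" and lu: "a \<le> l" "u \<le> b"
    and q: "F (\<phi> q) \<in> \<phi> ` {l<..<u}" and p: "F (\<phi> p) \<notin> \<phi> ` {l<..<u}"
  obtains s where "p \<le> s" "s < q" "F (\<phi> s) = \<phi> l \<or> F (\<phi> s) = \<phi> u"
    "\<And>r. s < r \<Longrightarrow> r \<le> q \<Longrightarrow> F (\<phi> r) \<in> \<phi> ` {l<..<u}"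
proof -
  define S where "S = {s \<in> {p..q}. F (\<phi> s) \<in> - \<phi> ` {l<..<u}}"
  have cF: "continuous_on {p..q} (\<lambda>s. F (\<phi> s))"
    using continuous_on_compose2[OF F continuous_on_subset[OF cont]] pq by auto
  have "closed S"
    unfolding S_def using continuous_closed_preimage[OF cF, of "- \<phi> ` {l<..<u}"] open_image[OF lu]
    by (simp add: vimage_def Int_def closed_Compl)
  moreover have "p \<in> S" using p pq by (simp add: S_def)
  moreover have bdd: "bdd_above S" by (auto simp: S_def intro: bdd_aboveI[of _ q])
  ultimately have s: "Sup S \<in> S"
    by (intro closed_contains_Sup) auto
  have s': "p \<le> Sup S" "Sup S < q" "F (\<phi> (Sup S)) \<notin> \<phi> ` {l<..<u}"
    using s q by (auto simp: S_def less_le)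
  have inside: "F (\<phi> r) \<in> \<phi> ` {l<..<u}" if "Sup S < r" "r \<le> q" for r
    using cSup_upper[OF _ bdd, of r] that s'(1) by (force simp: S_def)
  have "closed ({p..q} \<inter> (\<lambda>s. F (\<phi> s)) -` (\<phi> ` {l..u}))"
    by (rule continuous_closed_preimage[OF cF]) (use closed_image lu in auto)
  moreover have "{Sup S<..q} \<subseteq> {p..q} \<inter> (\<lambda>s. F (\<phi> s)) -` (\<phi> ` {l..u})"
    using inside s'(1) by fastforce
  ultimately have "closure {Sup S<..q} \<subseteq> {p..q} \<inter> (\<lambda>s. F (\<phi> s)) -` (\<phi> ` {l..u})"
    by (rule closure_minimal[rotated])
  then have "F (\<phi> (Sup S)) \<in> \<phi> ` {l..u}"
    using s'(2) by (simp add: subset_iff)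
  then have "F (\<phi> (Sup S)) = \<phi> l \<or> F (\<phi> (Sup S)) = \<phi> u"
    using s'(3) by (force simp: less_le)
  then show thesis using that s' inside by blast
qed

lemma less_coordinate_iff:
  assumes F: "continuous_on UNIV F" and pq: "a \<le> p" "p \<le> q" "q \<le> b"
    and im: "\<And>s. s \<in> {p..q} \<Longrightarrow> F (\<phi> s) \<in> \<phi> ` {a..b}"
    and nofix: "\<And>s. s \<in> {p..q} \<Longrightarrow> F (\<phi> s) \<noteq> \<phi> s"
  shows "p < \<psi> (F (\<phi> p)) \<longleftrightarrow> q < \<psi> (F (\<phi> q))"
proof -
  define g where "g = (\<lambda>s. \<psi> (F (\<phi> s)) - s)"
  have cg: "continuous_on {p..q} g"
    unfolding g_def by (intro continuous_intros continuous_coordinate[OF F]) (use pq im in auto)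
  have nz: "g s \<noteq> 0" if "s \<in> {p..q}" for s
    using im[OF that] nofix[OF that] unfolding g_def by auto
  have "g p \<le> 0 \<Longrightarrow> 0 \<le> g q \<Longrightarrow> False"
    using IVT'[of g p 0 q] cg pq nz by force
  moreover have "g q \<le> 0 \<Longrightarrow> 0 \<le> g p \<Longrightarrow> False"
    using IVT2'[of g q 0 p] cg pq nz by force
  ultimately show ?thesis unfolding g_def by force
qed

lemma exit_left:
  assumes F: "continuous_on UNIV F" and q: "q \<le> b"
    and v: "F (\<phi> q) = \<phi> v" "a < v" "v < q"
    and a: "F (\<phi> a) \<notin> \<phi> ` {a..<b}"
    and nofix: "\<And>s. s \<in> {a<..q} \<Longrightarrow> F (\<phi> s) \<noteq> \<phi> s"
  obtains t where "a < t" "t < q" "F (\<phi> t) = \<phi> a"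
    "\<And>s. s \<in> {t..q} \<Longrightarrow> F (\<phi> s) \<in> \<phi> ` {a..<q}"
proof -
  have "F (\<phi> q) \<in> \<phi> ` {a<..<q}" "F (\<phi> a) \<notin> \<phi> ` {a<..<q}"
    using v a q by fastforce+
  then obtain t where t: "a \<le> t" "t < q" "F (\<phi> t) = \<phi> a \<or> F (\<phi> t) = \<phi> q"
      "\<And>r. t < r \<Longrightarrow> r \<le> q \<Longrightarrow> F (\<phi> r) \<in> \<phi> ` {a<..<q}"
    using exit_endpoint[OF F, of a q a q] v q by auto
  have im: "F (\<phi> s) \<in> \<phi> ` {a..q}" if "s \<in> {t..q}" for s
    using t(4)[of s] t(1-3) that by (cases "s = t") fastforce+
  have nofix_a: "F (\<phi> a) \<noteq> \<phi> a"
    using a v q by fastforce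
  have "t < \<psi> (F (\<phi> t)) \<longleftrightarrow> q < \<psi> (F (\<phi> q))"
  proof (rule less_coordinate_iff[OF F])
    show "F (\<phi> s) \<noteq> \<phi> s" if "s \<in> {t..q}" for s
      using nofix[of s] nofix_a t(1) that by (cases "s = a") auto
    show "F (\<phi> s) \<in> \<phi> ` {a..b}" if "s \<in> {t..q}" for s
      using im[OF that] q by fastforce
  qed (use t q in auto)
  then have Ft: "F (\<phi> t) = \<phi> a" using t(1-3) v q by auto
  then have "a < t" using nofix_a t(1) by (cases "t = a") auto
  moreover have "F (\<phi> s) \<in> \<phi> ` {a..<q}" if "s \<in> {t..q}" for s
    using t(4)[of s] t(1,2) Ft that by (cases "s = t") fastforce+
  ultimately show thesis using that[OF _ t(2) Ft] by blast
qed

lemma exit_right: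
  assumes F: "continuous_on UNIV F" and u: "u < b"
    and v: "F (\<phi> q) = \<phi> v" "a < q" "q < v" "v < u"
    and a: "F (\<phi> a) \<notin> \<phi> ` {a..<b}"
    and nofix: "\<And>s. s \<in> {a<..q} \<Longrightarrow> F (\<phi> s) \<noteq> \<phi> s"
  obtains t where "a < t" "t < q" "F (\<phi> t) = \<phi> u"
    "\<And>s. s \<in> {t..q} \<Longrightarrow> F (\<phi> s) \<in> \<phi> ` {a<..u}"
proof -
  have "F (\<phi> q) \<in> \<phi> ` {a<..<u}" "F (\<phi> a) \<notin> \<phi> ` {a<..<u}"
    using v a u by fastforce+
  then obtain t where t: "a \<le> t" "t < q" "F (\<phi> t) = \<phi> a \<or> F (\<phi> t) = \<phi> u"
      "\<And>r. t < r \<Longrightarrow> r \<le> q \<Longrightarrow> F (\<phi> r) \<in> \<phi> ` {a<..<u}"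
    using exit_endpoint[OF F, of a q a u] v u by auto
  have im: "F (\<phi> s) \<in> \<phi> ` {a..u}" if "s \<in> {t..q}" for s
    using t(4)[of s] t(1-3) v that by (cases "s = t") fastforce+
  have nofix_a: "F (\<phi> a) \<noteq> \<phi> a"
    using a v u by fastforce
  have "t < \<psi> (F (\<phi> t)) \<longleftrightarrow> q < \<psi> (F (\<phi> q))"
  proof (rule less_coordinate_iff[OF F])
    show "F (\<phi> s) \<noteq> \<phi> s" if "s \<in> {t..q}" for s
      using nofix[of s] nofix_a t(1) that by (cases "s = a") auto
    show "F (\<phi> s) \<in> \<phi> ` {a..b}" if "s \<in> {t..q}" for s
      using im[OF that] u by fastforce
  qed (use t v u in auto)
  then have Ft: "F (\<phi> t) = \<phi> u" using t(1-3) v u by auto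
  have "t \<noteq> a" using Ft a v u by fastforce
  then have "a < t" using t(1) by simp
  moreover have "F (\<phi> s) \<in> \<phi> ` {a<..u}" if "s \<in> {t..q}" for s
    using t(4)[of s] t(1,2) v Ft that by (cases "s = t") fastforce+
  ultimately show thesis using that[OF _ t(2) Ft] by blast
qed

context
  fixes f :: "'a \<Rightarrow> 'a"
  assumes f: "continuous_on UNIV f"
begin

lemma Rec_return:
  assumes "\<phi> z \<in> Rec f" "a \<le> c" "c < z" "z < d" "d \<le> b"
  obtains n s where "n > N" "c < s" "s < d" "(f ^^ n) (\<phi> z) = \<phi> s"
proof -
  have "open (\<phi> ` {c<..<d})" "\<phi> z \<in> \<phi> ` {c<..<d}"
    using open_image assms by auto
  then obtain n where "n \<ge> Suc N" "(f ^^ n) (\<phi> z) \<in> \<phi> ` {c<..<d}"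
    using assms(1) unfolding Rec_def by blast
  then show thesis using that[of n] by (auto simp: Suc_le_eq)
qed

lemma funpow_diff_apply:
  assumes "(f ^^ n) x = y" "(f ^^ m) x = z" "n < m"
  shows "(f ^^ (m - n)) y = z"
proof -
  have "z = (f ^^ (m - n + n)) x" using assms by simp
  also have "\<dots> = (f ^^ (m - n)) ((f ^^ n) x)" by (simp only: funpow_add comp_apply)
  finally show ?thesis using assms by simp
qed

text \<open>If the first return goes to the wrong side, then the next return to an even closer
  neighbourhood comes back from there.\<close>
lemma Rec_return_left:
  assumes z: "\<phi> z \<in> Rec f" "a \<le> c" "c < z" "z < d" "d \<le> b"
    and per: "\<And>s. s \<in> {c<..<d} \<Longrightarrow> \<phi> s \<notin> Per f"
  obtains n w v where "n \<ge> 1" "(f ^^ n) (\<phi> w) = \<phi> v" "c < v" "v < w" "w < d"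
proof -
  obtain n s where n: "n > 0" "c < s" "s < d" "(f ^^ n) (\<phi> z) = \<phi> s"
    using Rec_return[OF z] .
  have "s \<noteq> z"
    using per[of z] z n unfolding Per_def by force
  show thesis
  proof (cases "s < z")
    case True
    then show thesis using that[of n z s] n z by simp
  next
    case False
    then have s: "z < s" using \<open>s \<noteq> z\<close> by simp
    obtain m r where m: "m > n" "c < r" "r < s" "(f ^^ m) (\<phi> z) = \<phi> r"
      using Rec_return[OF z(1-3) s] n z by auto
    then show thesis
      using that[of "m - n" s r] funpow_diff_apply[OF n(4) m(4,1)] n by auto
  qed
qed

lemma Rec_return_right:
  assumes z: "\<phi> z \<in> Rec f" "a \<le> c" "c < z" "z < d" "d \<le> b"
    and per: "\<And>s. s \<in> {c<..<d} \<Longrightarrow> \<phi> s \<notin> Per f"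
  obtains n w v where "n \<ge> 1" "(f ^^ n) (\<phi> w) = \<phi> v" "c < w" "w < v" "v < d"
proof -
  obtain n s where n: "n > 0" "c < s" "s < d" "(f ^^ n) (\<phi> z) = \<phi> s"
    using Rec_return[OF z] .
  have "s \<noteq> z"
    using per[of z] z n unfolding Per_def by force
  show thesis
  proof (cases "s > z")
    case True
    then show thesis using that[of n z s] n z by simp
  next
    case False
    then have s: "s < z" using \<open>s \<noteq> z\<close> by simp
    have "a \<le> s" using n z by simp
    obtain m r where m: "m > n" "s < r" "r < d" "(f ^^ m) (\<phi> z) = \<phi> r"
      using Rec_return[OF z(1) \<open>a \<le> s\<close> s z(4,5)] .
    then show thesis
      using that[of "m - n" s r] funpow_diff_apply[OF n(4) m(4,1)] n by auto
  qed
qed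

theorem Per_near_limit_of_Rec:
  assumes ab: "a < b"
    and noreturn: "\<And>n. n \<ge> 1 \<Longrightarrow> (f ^^ n) (\<phi> a) \<notin> \<phi> ` {a..<b}"
    and rec: "\<And>d. a < d \<Longrightarrow> \<exists>s. a < s \<and> s < d \<and> \<phi> s \<in> Rec f"
  shows "\<exists>s\<in>{a<..<b}. \<phi> s \<in> Per f"
proof (rule ccontr)
  assume "\<not> ?thesis"
  then have per: "\<phi> s \<notin> Per f" if "s \<in> {a<..<b}" for s
    using that by blast
  then have nofix: "(f ^^ n) (\<phi> s) \<noteq> \<phi> s" if "s \<in> {a<..<b}" "n \<ge> 1" for s n
    using that unfolding Per_def by blast
  note cf = continuous_on_funpow_UNIV[OF f, of UNIV]
  obtain z where z: "a < z" "z < b" "\<phi> z \<in> Rec f"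
    using rec[OF ab] by blast
  obtain n y v where n: "n \<ge> 1" and y: "(f ^^ n) (\<phi> y) = \<phi> v" "a < v" "v < y" "y < b"
    using Rec_return_left[OF z(3) order_refl z(1,2) order_refl per] .
  obtain t where t: "a < t" "t < y" "(f ^^ n) (\<phi> t) = \<phi> a"
      and t_im: "\<And>s. s \<in> {t..y} \<Longrightarrow> (f ^^ n) (\<phi> s) \<in> \<phi> ` {a..<y}"
    using exit_left[OF cf _ y(1-3) noreturn[OF n]] nofix[OF _ n] y by auto
  define d where "d = min t v"
  have d: "a < d" "d \<le> t" "d \<le> v" "d \<le> b"
    using t y by (auto simp: d_def)
  obtain z' where z': "a < z'" "z' < d" "\<phi> z' \<in> Rec f"
    using rec[OF d(1)] by blast
  obtain m w u where m: "m \<ge> 1" and w: "(f ^^ m) (\<phi> w) = \<phi> u" "a < w" "w < u" "u < d"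
    using Rec_return_right[OF z'(3) order_refl z'(1,2) d(4)] per d by auto
  obtain c where c: "a < c" "c < w" "(f ^^ m) (\<phi> c) = \<phi> y"
      and c_im: "\<And>s. s \<in> {c..w} \<Longrightarrow> (f ^^ m) (\<phi> s) \<in> \<phi> ` {a<..y}"
  proof (rule exit_right[OF cf y(4) w(1-3) _ noreturn[OF m]])
    show "u < y" using w d t by simp
    show "(f ^^ m) (\<phi> s) \<noteq> \<phi> s" if "s \<in> {a<..w}" for s
      using nofix[OF _ m] w d that by auto
  qed (rule that)
  define g where "g = (\<lambda>s. \<psi> ((f ^^ m) (\<phi> s)))"
  define h where "h = (\<lambda>s. \<psi> ((f ^^ n) (\<phi> s)))"
  have g: "g c = y" "g w = u"
    using c w y d t by (auto simp: g_def)
  have cg: "continuous_on {c..w} g"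
    unfolding g_def by (rule continuous_coordinate[OF cf]) (use c w y d t c_im in fastforce)+
  have \<phi>_g: "\<phi> (g s) = (f ^^ m) (\<phi> s)" if "s \<in> {c..w}" for s
    using c_im[OF that] y by (auto simp: g_def)
  have ch: "continuous_on {t..y} h"
    unfolding h_def by (rule continuous_coordinate[OF cf]) (use y t t_im in fastforce)+
  have \<phi>_h: "\<phi> (h s) = (f ^^ n) (\<phi> s)" if "s \<in> {t..y}" for s
    using t_im[OF that] y by (auto simp: h_def)
  define S where "S = {s \<in> {c..w}. g s \<in> {..t}}"
  have "closed S"
    unfolding S_def using continuous_closed_preimage[OF cg, of "{..t}"]
    by (simp add: vimage_def Int_def)
  moreover have "w \<in> S" using g w d c by (auto simp: S_def)
  moreover have bdd: "bdd_below S" by (auto simp: S_def)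
  ultimately have e: "Inf S \<in> S"
    by (intro closed_contains_Inf) auto
  define e where "e = Inf S"
  have e: "c \<le> e" "e \<le> w" "g e \<le> t"
    using e by (auto simp: S_def e_def)
  have g_above: "t < g s" if "s \<in> {c..<e}" for s
    using cInf_lower[OF _ bdd, of s] that e by (force simp: S_def e_def)
  have "g e = t"
  proof -
    obtain s where "c \<le> s" "s \<le> e" "g s = t"
      using IVT2'[of g e t c] e g t continuous_on_subset[OF cg, of "{c..e}"] by auto
    then show ?thesis using g_above[of s] by (cases "s = e") auto
  qed
  have g_im: "g s \<in> {t..y}" if "s \<in> {c..e}" for s
  proof -
    have "g s \<le> y" using c_im[of s] that e y by (auto simp: g_def)
    then show ?thesis using g_above[of s] \<open>g e = t\<close> that by (cases "s = e") auto
  qed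
  have "continuous_on {c..e} (\<lambda>s. h (g s) - s)"
    by (intro continuous_intros continuous_on_compose2[OF ch continuous_on_subset[OF cg]])
      (use g_im e in auto)
  moreover have "h (g c) = v" "h (g e) = a"
    using g \<open>g e = t\<close> y t ab by (auto simp: h_def)
  ultimately obtain s where s: "c \<le> s" "s \<le> e" "h (g s) - s = 0"
    using IVT2'[of "\<lambda>s. h (g s) - s" e 0 c] e c w d by auto
  then have "(f ^^ n) ((f ^^ m) (\<phi> s)) = \<phi> s"
    using \<phi>_h[OF g_im, of s] \<phi>_g[of s] e by auto
  then have "(f ^^ (n + m)) (\<phi> s) = \<phi> s"
    by (simp add: funpow_add)
  moreover have "s \<in> {a<..<b}" using s c e w d t y by auto
  ultimately show False using nofix[of s "n + m"] n by auto
qed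

end

end

theorem theorem20:
  fixes f :: "'a::t2_space \<Rightarrow> 'a" and J :: "'a set"
  assumes "free_interval J"
    and "continuous_on UNIV f"
  shows "closure (Rec f) \<inter> J = (Rec f \<union> closure (Per f)) \<inter> J"
proof
  show "(Rec f \<union> closure (Per f)) \<inter> J \<subseteq> closure (Rec f) \<inter> J"
    using closure_mono[OF Per_subset_Rec] closure_subset by blast
  show "closure (Rec f) \<inter> J \<subseteq> (Rec f \<union> closure (Per f)) \<inter> J"
  proof (rule ccontr)
    assume "\<not> ?thesis"
    then obtain x where x: "x \<in> closure (Rec f)" "x \<in> J" "x \<notin> Rec f" "x \<notin> closure (Per f)"
      by blast
    obtain I :: "real set" and \<psi> \<phi> where J: "open J" and I: "open I" and "homeomorphism J I \<psi> \<phi>"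
      using assms(1) unfolding free_interval_def homeomorphic_def by blast
    then have \<phi>: "continuous_on I \<phi>" "\<phi> ` I = J" "continuous_on J \<psi>"
        "\<And>s. s \<in> I \<Longrightarrow> \<psi> (\<phi> s) = s" "\<And>r. r \<in> J \<Longrightarrow> \<phi> (\<psi> r) = r" "\<psi> ` J = I"
      by (auto simp: homeomorphism_def)
    have open_image: "open (\<phi> ` A)" if "open A" "A \<subseteq> I" for A
    proof -
      have "\<phi> ` A = \<psi> -` A \<inter> J" using \<phi> that(2) by force
      then show ?thesis using continuous_on_open_vimage[OF J] \<phi>(3) that(1) by metis
    qed
    define x0 where "x0 = \<psi> x"
    have x0: "x0 \<in> I" "\<phi> x0 = x" using \<phi> x by (auto simp: x0_def)
    have x_noper: "(f ^^ n) x \<noteq> x" if "n \<ge> 1" for n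
      using x(4) closure_subset[of "Per f"] that by (auto simp: Per_def)
    obtain U N where U: "open U" "x \<in> U" "\<And>n. n \<ge> N \<Longrightarrow> (f ^^ n) x \<notin> U"
      using x(3) unfolding Rec_def by blast
    define V where "V = U - closure (Per f) - (\<lambda>n. (f ^^ n) x) ` {1..<N}"
    have "x \<noteq> (f ^^ n) x" if "n \<ge> 1" for n
      using x_noper[OF that] by simp
    then have V: "open V" "x \<in> V"
      unfolding V_def using U x by (auto intro!: open_Diff finite_imp_closed[OF finite_imageI])
    have V_Per: "V \<inter> Per f = {}"
      unfolding V_def using closure_subset by blast
    have V_orbit: "(f ^^ n) x \<notin> V" if "n \<ge> 1" for n
      using U(3)[of n] that unfolding V_def by (cases "n \<ge> N") auto
    have "open (\<phi> -` V \<inter> I)"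
      using continuous_on_open_vimage[OF I] \<phi>(1) V(1) by blast
    then obtain e where e: "e > 0" "cball x0 e \<subseteq> \<phi> -` V \<inter> I"
      using x0 V by (metis IntI open_contains_cball vimageI)
    then have e': "s \<in> I" "\<phi> s \<in> V" if "\<bar>s - x0\<bar> \<le> e" for s
      using that by (auto simp: dist_real_def subset_iff abs_minus_commute)
    have one_sided: False
      if \<sigma>: "\<sigma> = 1 \<or> \<sigma> = -1"
        and rec: "\<And>d. 0 < d \<Longrightarrow> \<exists>s. 0 < s \<and> s < d \<and> \<phi> (x0 + \<sigma> * s) \<in> Rec f" for \<sigma> :: real
    proof -
      have near: "x0 + \<sigma> * s \<in> I" "\<phi> (x0 + \<sigma> * s) \<in> V" if "s \<in> {0..e}" for s
        using e'[of "x0 + \<sigma> * s"] \<sigma> that by auto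
      interpret open_arc "\<lambda>s. \<phi> (x0 + \<sigma> * s)" 0 e
      proof
        show "continuous_on {0..e} (\<lambda>s. \<phi> (x0 + \<sigma> * s))"
          by (intro continuous_on_compose2[OF \<phi>(1)] continuous_intros) (use near in auto)
        show "inj_on (\<lambda>s. \<phi> (x0 + \<sigma> * s)) {0..e}"
          using near(1) \<phi>(4) \<sigma>
          by (intro inj_onI)
            (metis add_left_cancel mult_cancel_left zero_neq_one zero_neq_neg_one)
        show "open ((\<lambda>s. \<phi> (x0 + \<sigma> * s)) ` {c<..<d})" if "0 \<le> c" "d \<le> e" for c d
        proof -
          have "open ((\<lambda>s. x0 + \<sigma> * s) ` {c<..<d})"
            using open_affinity[of "{c<..<d}" \<sigma> x0] \<sigma> by auto
          then have "open (\<phi> ` (\<lambda>s. x0 + \<sigma> * s) ` {c<..<d})"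
            by (rule open_image) (use near(1) that in auto)
          then show ?thesis by (simp add: image_image)
        qed
      qed
      have "\<exists>s\<in>{0<..<e}. \<phi> (x0 + \<sigma> * s) \<in> Per f"
      proof (rule Per_near_limit_of_Rec[OF assms(2) e(1) _ rec])
        show "(f ^^ n) (\<phi> (x0 + \<sigma> * 0)) \<notin> (\<lambda>s. \<phi> (x0 + \<sigma> * s)) ` {0..<e}" if "n \<ge> 1" for n
          using V_orbit[OF that] near(2) x0(2) by fastforce
      qed
      then obtain s where "s \<in> {0<..<e}" "\<phi> (x0 + \<sigma> * s) \<in> Per f" by blast
      then show False using near(2)[of s] V_Per by auto
    qed
    obtain d1 where d1: "d1 > 0" "\<And>s. 0 < s \<Longrightarrow> s < d1 \<Longrightarrow> \<phi> (x0 + s) \<notin> Rec f"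
      using one_sided[of 1] by auto
    obtain d2 where d2: "d2 > 0" "\<And>s. 0 < s \<Longrightarrow> s < d2 \<Longrightarrow> \<phi> (x0 - s) \<notin> Rec f"
      using one_sided[of "-1"] by auto
    define d where "d = min e (min d1 d2)"
    have d: "d > 0" "d \<le> e" "d \<le> d1" "d \<le> d2" using e d1 d2 by (auto simp: d_def)
    have "open (\<phi> ` {x0 - d<..<x0 + d})"
      by (rule open_image) (use e'(1) d(2) in auto)
    moreover have "x \<in> \<phi> ` {x0 - d<..<x0 + d}"
      using x0 d by auto
    ultimately have "\<phi> ` {x0 - d<..<x0 + d} \<inter> Rec f \<noteq> {}"
      using x(1) by (meson open_Int_closure_eq_empty disjoint_iff)
    then obtain s where s: "x0 - d < s" "s < x0 + d" "\<phi> s \<in> Rec f"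
      by auto
    consider "s = x0" | "s < x0" | "s > x0" by linarith
    then show False
    proof cases
      case 1
      then show False using s x0 x by simp
    next
      case 2
      then show False using d2(2)[of "x0 - s"] s d by simp
    next
      case 3
      then show False using d1(2)[of "s - x0"] s d by simp
    qed
  qed
qed

end
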